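(* Let $n\ge 1$, let $P$ be a finite partially ordered set, let $R$ be a partially ordered set, and let $\psi:P\times[n]\to R$ be an isotone map with left strict chain fibers. Let $\mathcal J$ be a poset ideal in $\mathrm{Hom}(P,[n])$. Let $\psi_1:\langle x_{P\times[n]}\rangle\to\langle x_R\rangle$ be the linear map with $x_{p,i}\mapsto x_{\psi(p,i)}$, and let $B$ be a basis of $\ker\psi_1$ consisting of differences $x_{p,i}-x_{p',i'}$ with $\psi(p,i)=\psi(p',i')$. Then $B$ is a regular sequence for the ring $\Bbbk[x_{P\times[n]}]/L(P,n;\mathcal J)$.
   Context: $\Bbbk$ is a field and $[n]=\{1<2<\cdots<n\}$ is the chain on $n$ elements. For a set $A$, $\Bbbk[x_A]$ is the polynomial ring in variables $x_a$, $a\in A$, and $\langle x_A\rangle$ is the $\Bbbk$-vector space spanned by these variables. A map of posets is isotone if it is order preserving; $\mathrm{Hom}(P,[n])$ is the set of isotone maps $P\to[n]$, partially ordered by $\phi\le\phi'$ iff $\phi(p)\le\phi'(p)$ for all $p$. A poset ideal of a poset is a subset $J$ such that $q\in J$ and $p\le q$ imply $p\in J$. Products of posets carry the componentwise order, and $[n]^{op}$ is the opposite poset of $[n]$. The co-letterplace ideal $L(P,n;\mathcal J)\subseteq\Bbbk[x_{P\times[n]}]$ of the poset ideal $\mathcal J$ is generated by all monomials $\prod_{p\in P}x_{p,\phi(p)}$ with $\phi\in\mathcal J$. A chain in a product of posets $Q\times Q'$ is left strict if for any two of its elements, $(a,b)<(a',b')$ implies $a<a'$. An isotone map $\psi:P\times[n]\to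 R$ has left strict chain fibers if every fiber $\psi^{-1}(r)$ is a left strict chain in $P\times[n]^{op}$. A sequence of elements is regular for a ring if each element is a nonzerodivisor on the quotient of the ring by the preceding elements (the elements here are homogeneous of degree one, so the quotient of a nonzero graded quotient ring by them is automatically nonzero). *)

theory Defs
  imports Complex_Main "HOL-Algebra.QuotRing" "HOL-Library.Poly_Mapping" "HOL-Library.FuncSet"
begin

section \<open>Posets\<close>

text \<open>A poset is a subset of a type of class \<^class>\<open>order\<close> with the induced order; the chain
  \<open>[n]\<close> is \<open>{1..n}\<close>. The componentwise order on a product is \<^const>\<open>rel_prod\<close> applied to the
  two orders, so that \<open>rel_prod (\<le>) (\<ge>)\<close> is the order of \<open>P \<times> [n]\<^sup>o\<^sup>p\<close>.\<close>

text \<open>Isotone maps are taken in \<^const>\<open>PiE\<close>, so that a map \<open>P \<rightarrow> [n]\<close> is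
  represented by exactly one function.\<close>

definition isotone_maps :: "'p::order set \<Rightarrow> nat \<Rightarrow> ('p \<Rightarrow> nat) set" where
  "isotone_maps P n = {\<phi> \<in> P \<rightarrow>\<^sub>E {1..n}. monotone_on P (\<le>) (\<le>) \<phi>}"

definition pointwise_le :: "'p set \<Rightarrow> ('p \<Rightarrow> nat) \<Rightarrow> ('p \<Rightarrow> nat) \<Rightarrow> bool" where
  "pointwise_le P \<phi> \<phi>' \<longleftrightarrow> (\<forall>p\<in>P. \<phi> p \<le> \<phi>' p)"

definition poset_ideal :: "('a \<Rightarrow> 'a \<Rightarrow> bool) \<Rightarrow> 'a set \<Rightarrow> 'a set \<Rightarrow> bool" where
  "poset_ideal ord X J \<longleftrightarrow> J \<subseteq> X \<and> (\<forall>q\<in>J. \<forall>p\<in>X. ord p q \<longrightarrow> p \<in> J)"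

definition left_strict_chain ::
    "('a \<Rightarrow> 'a \<Rightarrow> bool) \<Rightarrow> ('b \<Rightarrow> 'b \<Rightarrow> bool) \<Rightarrow> ('a \<times> 'b) set \<Rightarrow> bool" where
  "left_strict_chain ord ord' C \<longleftrightarrow>
     Complete_Partial_Order.chain (rel_prod ord ord') C \<and>
     (\<forall>(a, b)\<in>C. \<forall>(a', b')\<in>C.
        rel_prod ord ord' (a, b) (a', b') \<and> (a, b) \<noteq> (a', b') \<longrightarrow> ord a a' \<and> a \<noteq> a')"

definition left_strict_chain_fibers ::
    "'p::order set \<Rightarrow> nat \<Rightarrow> 'r set \<Rightarrow> ('p \<times> nat \<Rightarrow> 'r) \<Rightarrow> bool" where
  "left_strict_chain_fibers P n R \<psi> \<longleftrightarrow>
     (\<forall>r\<in>R. left_strict_chain (\<le>) (\<ge>) {a \<in> P \<times> {1..n}. \<psi> a = r})"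


section \<open>Polynomial rings\<close>

text \<open>Monomials are finitely supported exponent functions, polynomials are finitely supported
  coefficient functions on monomials; addition and multiplication are those of
  \<^theory>\<open>HOL-Library.Poly_Mapping\<close>.\<close>

type_synonym ('v, 'k) mpoly = "('v \<Rightarrow>\<^sub>0 nat) \<Rightarrow>\<^sub>0 'k"

definition Var :: "'v \<Rightarrow> ('v, 'k::field) mpoly" where
  "Var v = Poly_Mapping.single (Poly_Mapping.single v 1) 1"

definition mpoly_scale :: "'k::field \<Rightarrow> ('v, 'k) mpoly \<Rightarrow> ('v, 'k) mpoly" where
  "mpoly_scale c f = Poly_Mapping.single 0 c * f"

global_interpretation mpoly: vector_space "mpoly_scale :: 'k::field \<Rightarrow> ('v, 'k) mpoly \<Rightarrow> _"
  by unfold_locales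
    (simp_all add: mpoly_scale_def algebra_simps single_add mult_single flip: mult.assoc)

definition poly_ring :: "'v set \<Rightarrow> ('v, 'k::field) mpoly ring" where
  "poly_ring A =
     \<lparr>carrier = {f. \<forall>m\<in>Poly_Mapping.keys f. Poly_Mapping.keys m \<subseteq> A},
      mult = (*), one = 1, zero = 0, add = (+)\<rparr>"

lemma poly_ring_sel [simp]:
  "mult (poly_ring A) = (*)" "one (poly_ring A) = 1"
  "zero (poly_ring A) = 0" "add (poly_ring A) = (+)"
  by (simp_all add: poly_ring_def)

lemma poly_ring_cring: "cring (poly_ring A :: ('v, 'k::field) mpoly ring)"
proof (rule cringI)
  have add_closed: "f + g \<in> carrier (poly_ring A)"
    if "f \<in> carrier (poly_ring A)" "g \<in> carrier (poly_ring A)" for f g :: "('v, 'k) mpoly"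
    using that Poly_Mapping.keys_add[of f g] by (auto simp: poly_ring_def)
  have mult_closed: "f * g \<in> carrier (poly_ring A)"
    if fg: "f \<in> carrier (poly_ring A)" "g \<in> carrier (poly_ring A)" for f g :: "('v, 'k) mpoly"
  proof -
    have "Poly_Mapping.keys m \<subseteq> A" if m: "m \<in> Poly_Mapping.keys (f * g)" for m
    proof -
      obtain l l' where l: "m = l + l'" "l \<in> Poly_Mapping.keys f" "l' \<in> Poly_Mapping.keys g"
        using keys_mult[of f g] m by blast
      then have "Poly_Mapping.keys l \<subseteq> A" "Poly_Mapping.keys l' \<subseteq> A"
        using fg by (simp_all add: poly_ring_def)
      then show ?thesis
        using Poly_Mapping.keys_add[of l l'] l(1) by (metis Un_least subset_trans)
    qed
    then show ?thesis
      by (simp add: poly_ring_def)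
  qed
  have zero_closed: "0 \<in> carrier (poly_ring A :: ('v, 'k) mpoly ring)"
    and one_closed: "1 \<in> carrier (poly_ring A :: ('v, 'k) mpoly ring)"
    by (simp_all add: poly_ring_def)
  have uminus_closed: "- f \<in> carrier (poly_ring A)"
    if "f \<in> carrier (poly_ring A)" for f :: "('v, 'k) mpoly"
    using that by (simp add: poly_ring_def)
  show "abelian_group (poly_ring A :: ('v, 'k) mpoly ring)"
  proof (rule abelian_groupI)
    fix f :: "('v, 'k) mpoly"
    assume "f \<in> carrier (poly_ring A)"
    then show "\<exists>g\<in>carrier (poly_ring A). g \<oplus>\<^bsub>poly_ring A\<^esub> f = \<zero>\<^bsub>poly_ring A\<^esub>"
      by (intro bexI[of _ "- f"]) (simp_all add: uminus_closed)
  qed (simp_all add: add_closed zero_closed add.assoc add.commute)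
  show "comm_monoid (poly_ring A :: ('v, 'k) mpoly ring)"
    by (rule comm_monoidI) (simp_all add: mult_closed one_closed mult.assoc mult.commute)
qed (simp add: distrib_right)

definition coletterplace_ideal ::
    "'p set \<Rightarrow> nat \<Rightarrow> ('p \<Rightarrow> nat) set \<Rightarrow> ('p \<times> nat, 'k::field) mpoly set" where
  "coletterplace_ideal P n J =
     Idl\<^bsub>poly_ring (P \<times> {1..n})\<^esub> ((\<lambda>\<phi>. \<Prod>p\<in>P. Var (p, \<phi> p)) ` J)"


section \<open>The linear map on linear forms\<close>

definition linear_forms :: "'v set \<Rightarrow> ('v, 'k::field) mpoly set" where
  "linear_forms A = mpoly.span (Var ` A)"

text \<open>For finite \<open>A\<close>, the linear map from \<open>linear_forms A\<close> that sends \<open>Var a\<close> to \<open>Var (\<psi> a)\<close>,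
  see the lemmas below.\<close>

definition var_map :: "'v set \<Rightarrow> ('v \<Rightarrow> 'w) \<Rightarrow> ('v, 'k::field) mpoly \<Rightarrow> ('w, 'k) mpoly" where
  "var_map A \<psi> f =
     (\<Sum>a\<in>A. mpoly_scale (Poly_Mapping.lookup f (Poly_Mapping.single a 1)) (Var (\<psi> a)))"

definition var_map_kernel :: "'v set \<Rightarrow> ('v \<Rightarrow> 'w) \<Rightarrow> ('v, 'k::field) mpoly set" where
  "var_map_kernel A \<psi> = {f \<in> linear_forms A. var_map A \<psi> f = 0}"

lemma lookup_mpoly_scale:
  "Poly_Mapping.lookup (mpoly_scale c f) m = c * Poly_Mapping.lookup f m"
  by (simp add: mpoly_scale_def map.rep_eq when_def flip: mult_map_scale_conv_mult)

lemma var_map_linear: "Vector_Spaces.linear mpoly_scale mpoly_scale (var_map A \<psi>)"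
  by unfold_locales
    (simp_all add: var_map_def lookup_add lookup_mpoly_scale mpoly.scale_left_distrib
      sum.distrib mpoly.scale_sum_right)

lemma var_map_Var:
  assumes "finite A" "a \<in> A"
  shows "var_map A \<psi> (Var a) = Var (\<psi> a)"
proof -
  have single_eq: "Poly_Mapping.single a (1::nat) = Poly_Mapping.single b 1 \<longleftrightarrow> a = b" for b :: 'a
    by (metis lookup_single_eq lookup_single_not_eq zero_neq_one)
  have "var_map A \<psi> (Var a) = (\<Sum>b\<in>A. if b = a then Var (\<psi> b) else 0)"
    unfolding var_map_def
    by (rule sum.cong) (auto simp: Var_def lookup_single when_def single_eq[unfolded One_nat_def])
  then show ?thesis
    using assms by simp
qed

definition is_basis :: "('v, 'k::field) mpoly set \<Rightarrow> ('v, 'k) mpoly set \<Rightarrow> bool" where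
  "is_basis B V \<longleftrightarrow> mpoly.independent B \<and> mpoly.span B = V"


section \<open>Regular sequences\<close>

definition nonzerodivisor :: "('a, 'b) ring_scheme \<Rightarrow> 'a \<Rightarrow> bool" where
  "nonzerodivisor S a \<longleftrightarrow>
     a \<in> carrier S \<and> (\<forall>b\<in>carrier S. a \<otimes>\<^bsub>S\<^esub> b = \<zero>\<^bsub>S\<^esub> \<longrightarrow> b = \<zero>\<^bsub>S\<^esub>)"

text \<open>There is no requirement that the quotient by the whole sequence is nonzero.\<close>

definition regular_sequence :: "('a, 'b) ring_scheme \<Rightarrow> 'a list \<Rightarrow> bool" where
  "regular_sequence S fs \<longleftrightarrow> set fs \<subseteq> carrier S \<and>
     (\<forall>i<length fs. let I = Idl\<^bsub>S\<^esub> (set (take i fs)) in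
        nonzerodivisor (S Quot I) (I +>\<^bsub>S\<^esub> (fs ! i)))"

end

theory Submission
  imports Defs
begin

text \<open>
  Let \<open>E\<close> be an initial segment of the sequence and \<open>x\<^sub>a - x\<^sub>b\<close> the next element. Dividing by \<open>E\<close>
  identifies variables along a map \<open>\<rho>\<close> whose classes refine the fibers of \<open>\<psi>\<close>
  (\<open>exists_representatives\<close>), and the co-letterplace ideal becomes the monomial ideal generated by the
  products \<open>\<Prod>p\<in>P. x\<^bsub>\<rho>(p,\<phi>(p))\<^esub>\<close> with \<open>\<phi> \<in> J\<close> (\<open>genideal_coletterplace_iff\<close>). Linear independence gives
  \<open>\<rho> a \<noteq> \<rho> b\<close>. So one has to show that the difference of two distinct variables \<open>r = \<rho> a\<close> and
  \<open>s = \<rho> b\<close> from the same fiber of \<open>\<psi>\<close> is a nonzerodivisor modulo this monomial ideal.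

  For a monomial ideal this holds as soon as no monomial outside the ideal is multiplied into it by
  both variables (\<open>var_diff_nonzerodivisor_mod_monomials\<close>). So let \<open>r u\<close> be divisible by the image
  generator of \<open>\<phi>\<close> and \<open>s u\<close> by that of \<open>\<chi>\<close>. If neither divides \<open>u\<close>, there are \<open>p\<close> and \<open>q\<close> such that
  \<open>\<phi>\<close> but not \<open>\<chi>\<close> uses \<open>r\<close> at \<open>p\<close>, and \<open>\<chi>\<close> but not \<open>\<phi>\<close> uses \<open>s\<close> at \<open>q\<close>. Left strictness makes
  \<open>p\<close> and \<open>q\<close> comparable, say \<open>p < q\<close>, and gives \<open>\<chi> q \<le> \<phi> p\<close>. The map that equals \<open>\<phi>\<close> above \<open>q\<close> and
  the minimum of \<open>\<phi>\<close> and \<open>\<chi>\<close> elsewhere is isotone and below \<open>\<phi>\<close>, hence in \<open>J\<close>. It drops \<open>r\<close> at \<open>p\<close> and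
  \<open>s\<close> at \<open>q\<close>, and on each class, again a left strict chain, its uses are all uses by \<open>\<phi>\<close> or all uses
  by \<open>\<chi>\<close> (\<open>hits_splice\<close>). So its image generator divides \<open>u\<close>
  (\<open>exists_below_if_exists_below_both\<close>).
\<close>

section \<open>Pushing coefficients forward along a map of the indices\<close>

text \<open>The same construction serves at two levels: \<open>push \<rho>\<close> substitutes variables in a monomial,
  and \<open>push (push \<rho>)\<close> is the resulting ring homomorphism on polynomials.\<close>

definition push :: "('a \<Rightarrow> 'b) \<Rightarrow> ('a \<Rightarrow>\<^sub>0 'c::comm_monoid_add) \<Rightarrow> 'b \<Rightarrow>\<^sub>0 'c" where
  "push h f = (\<Sum>k\<in>Poly_Mapping.keys f. Poly_Mapping.single (h k) (Poly_Mapping.lookup f k))"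

lemma push_zero [simp]: "push h 0 = 0"
  by (simp add: push_def)

lemma push_single [simp]: "push h (Poly_Mapping.single k c) = Poly_Mapping.single (h k) c"
  by (simp add: push_def)

lemma push_add: "push h (f + g) = push h f + push h g"
  unfolding push_def by (rule setsum_keys_plus_distrib) (simp_all add: single_add)

lemma push_sum: "push h (sum f I) = (\<Sum>i\<in>I. push h (f i))"
  by (induction I rule: infinite_finite_induct) (simp_all add: push_add)

lemma push_diff:
  fixes f g :: "'a \<Rightarrow>\<^sub>0 'c::ab_group_add"
  shows "push h (f - g) = push h f - push h g"
  using push_add[of h "f - g" g] by (simp add: algebra_simps)

lemma keys_push: "Poly_Mapping.keys (push h f) \<subseteq> h ` Poly_Mapping.keys f"
  unfolding push_def by (rule order_trans[OF keys_sum]) auto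

lemma sum_of_singles:
  "(\<Sum>k\<in>Poly_Mapping.keys f. Poly_Mapping.single k (Poly_Mapping.lookup f k)) = f"
  by (rule poly_mapping_eqI)
    (simp add: lookup_sum lookup_single when_def in_keys_iff)

lemma push_mult:
  fixes f g :: "'a::comm_monoid_add \<Rightarrow>\<^sub>0 'c::comm_semiring_0"
    and h :: "'a \<Rightarrow> 'b::comm_monoid_add"
  assumes add: "\<And>k l. h (k + l) = h k + h l"
  shows "push h (f * g) = push h f * push h g"
proof -
  let ?s = "\<lambda>f k. Poly_Mapping.single k (Poly_Mapping.lookup f k)"
    and ?s' = "\<lambda>f k. Poly_Mapping.single (h k) (Poly_Mapping.lookup f k)"
  have "f * g = (\<Sum>k\<in>Poly_Mapping.keys f. \<Sum>l\<in>Poly_Mapping.keys g. ?s f k * ?s g l)"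
    by (simp add: sum_of_singles flip: sum_product)
  then have "push h (f * g) = (\<Sum>k\<in>Poly_Mapping.keys f. \<Sum>l\<in>Poly_Mapping.keys g.
      ?s' f k * ?s' g l)"
    by (simp add: push_sum mult_single add)
  then show ?thesis
    unfolding push_def[of h f] push_def[of h g] sum_product .
qed

abbreviation subst_vars :: "('v \<Rightarrow> 'w) \<Rightarrow> ('v, 'k::field) mpoly \<Rightarrow> ('w, 'k) mpoly" where
  "subst_vars \<rho> \<equiv> push (push \<rho>)"

lemma subst_vars_Var [simp]: "subst_vars \<rho> (Var v) = Var (\<rho> v)"
  by (simp add: Var_def)

lemma subst_vars_mult: "subst_vars \<rho> (f * g) = subst_vars \<rho> f * subst_vars \<rho> g"
  by (rule push_mult) (rule push_add)

lemma Var_eq_iff [simp]: "(Var v :: ('v, 'k::field) mpoly) = Var w \<longleftrightarrow> v = w"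
  by (metis Var_def lookup_single_eq lookup_single_not_eq zero_neq_one)


section \<open>Monomial ideals\<close>

definition up_closed :: "('v \<Rightarrow>\<^sub>0 nat) set \<Rightarrow> bool" where
  "up_closed U \<longleftrightarrow> (\<forall>u\<in>U. \<forall>w. u + w \<in> U)"

lemma lookup_Var_times:
  "Poly_Mapping.lookup (Var v * h) (Poly_Mapping.single v 1 + m) = Poly_Mapping.lookup h m"
  by (simp add: Var_def lookup_mult lookup_single when_mult)

lemma keys_Var_times:
  assumes "m \<in> Poly_Mapping.keys (Var v * h)"
  obtains m' where "m' \<in> Poly_Mapping.keys h" "m = Poly_Mapping.single v 1 + m'"
  using keys_mult[of "Var v" h] assms by (auto simp: Var_def split: if_splits)

text \<open>If \<open>U\<close> is saturated with respect to the variable \<open>s\<close>, compare top degrees in \<open>s\<close>: a monomial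
  \<open>m \<notin> U\<close> of \<open>h\<close> with maximal \<open>s\<close>-degree yields \<open>s m \<notin> U\<close>, and no term of \<open>r h\<close> outside \<open>U\<close> reaches
  that \<open>s\<close>-degree, so nothing cancels it.\<close>

lemma keys_subset_if_diff_times_keys_subset:
  assumes U: "up_closed U" and sat: "\<And>u. u + Poly_Mapping.single s 1 \<in> U \<Longrightarrow> u \<in> U"
    and "r \<noteq> s" and keys: "Poly_Mapping.keys ((Var r - Var s) * h) \<subseteq> U"
  shows "Poly_Mapping.keys h \<subseteq> U"
proof (rule ccontr)
  assume "\<not> Poly_Mapping.keys h \<subseteq> U"
  then obtain m where m: "m \<in> Poly_Mapping.keys h - U"
    and max: "\<And>m'. m' \<in> Poly_Mapping.keys h - U \<Longrightarrow> Poly_Mapping.lookup m' s \<le> Poly_Mapping.lookup m s"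
  proof -
    let ?S = "Poly_Mapping.keys h - U" and ?d = "\<lambda>m. Poly_Mapping.lookup m s"
    assume "\<not> Poly_Mapping.keys h \<subseteq> U"
    then have "Max (?d ` ?S) \<in> ?d ` ?S"
      by (intro Max_in) auto
    then obtain m where "m \<in> ?S" "?d m = Max (?d ` ?S)"
      by auto
    then show ?thesis
      by (intro that[of m]) auto
  qed
  let ?e = "Poly_Mapping.single s (1::nat)"
  have out: "?e + m \<notin> U"
    using m sat[of m] by (auto simp: add.commute)
  have "?e + m \<notin> Poly_Mapping.keys (Var r * h)"
  proof
    assume "?e + m \<in> Poly_Mapping.keys (Var r * h)"
    then obtain m' where m': "m' \<in> Poly_Mapping.keys h" "?e + m = Poly_Mapping.single r 1 + m'"
      by (rule keys_Var_times)
    have "m' \<notin> U"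
      using out U m'(2) unfolding up_closed_def by (metis add.commute)
    then have "Poly_Mapping.lookup m' s \<le> Poly_Mapping.lookup m s"
      using max m'(1) by blast
    moreover have "Poly_Mapping.lookup m' s = Poly_Mapping.lookup m s + 1"
      using arg_cong[OF m'(2), of "\<lambda>x. Poly_Mapping.lookup x s"] \<open>r \<noteq> s\<close>
      by (simp add: lookup_add lookup_single)
    ultimately show False by simp
  qed
  then have "Poly_Mapping.lookup ((Var r - Var s) * h) (?e + m) \<noteq> 0"
    using m by (simp add: left_diff_distrib lookup_minus lookup_Var_times in_keys_iff
        flip: One_nat_def)
  then show False
    using keys out by (auto simp: in_keys_iff)
qed

text \<open>In terms of primes: a difference of two variables is a zero divisor modulo a monomial ideal only
  if some associated prime, which has the form \<open>U : m\<close> for a monomial \<open>m\<close>, contains both variables.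
  The elementary argument uses that the hypothesis \<open>sat\<close> makes \<open>U\<close> the intersection of its
  saturations with respect to \<open>r\<close> and to \<open>s\<close>, to which the previous lemma applies.\<close>

lemma var_diff_nonzerodivisor_mod_monomials:
  assumes U: "up_closed U"
    and sat: "\<And>u. u + Poly_Mapping.single r 1 \<in> U \<Longrightarrow> u + Poly_Mapping.single s 1 \<in> U \<Longrightarrow> u \<in> U"
    and "r \<noteq> s" and keys: "Poly_Mapping.keys ((Var r - Var s) * h) \<subseteq> U"
  shows "Poly_Mapping.keys h \<subseteq> U"
proof -
  define sat_at where
    "sat_at v = {u. \<exists>k. u + Poly_Mapping.single v (k::nat) \<in> U}" for v
  have sub: "U \<subseteq> sat_at v" for v
    unfolding sat_at_def by (auto intro!: exI[of _ 0])
  have up: "up_closed (sat_at v)" for v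
    using U unfolding sat_at_def up_closed_def by (auto, metis add.assoc add.commute)
  have stable: "u \<in> sat_at v" if u: "u + Poly_Mapping.single v 1 \<in> sat_at v" for u v
  proof -
    obtain k where "u + Poly_Mapping.single v 1 + Poly_Mapping.single v k \<in> U"
      using u unfolding sat_at_def by blast
    then have "u + Poly_Mapping.single v (1 + k) \<in> U"
      by (simp only: single_add add.assoc)
    then show ?thesis
      unfolding sat_at_def by blast
  qed
  \<comment> \<open>Induction on \<open>k + l\<close>: both \<open>r u\<close> and \<open>s u\<close> satisfy the premises with a smaller sum.\<close>
  have inter: "u \<in> U"
    if "u + Poly_Mapping.single r k \<in> U" "u + Poly_Mapping.single s l \<in> U" for u k l
    using that
  proof (induction "k + l" arbitrary: u k l rule: less_induct)
    case less
    show ?case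
    proof (cases "k = 0 \<or> l = 0")
      case True
      then show ?thesis using less.prems by auto
    next
      case False
      then obtain k' l' where kl: "k = 1 + k'" "l = 1 + l'"
        by (metis not0_implies_Suc plus_1_eq_Suc)
      have "u + Poly_Mapping.single r 1 \<in> U"
      proof (rule less.hyps)
        show "u + Poly_Mapping.single r 1 + Poly_Mapping.single r k' \<in> U"
          using less.prems(1) unfolding kl by (simp only: single_add add.assoc)
        show "u + Poly_Mapping.single r 1 + Poly_Mapping.single s l \<in> U"
          using less.prems(2) U unfolding up_closed_def by (metis add.assoc add.commute)
      qed (simp add: kl)
      moreover have "u + Poly_Mapping.single s 1 \<in> U"
      proof (rule less.hyps)
        show "u + Poly_Mapping.single s 1 + Poly_Mapping.single s l' \<in> U"
          using less.prems(2) unfolding kl by (simp only: single_add add.assoc)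
        show "u + Poly_Mapping.single s 1 + Poly_Mapping.single r k \<in> U"
          using less.prems(1) U unfolding up_closed_def by (metis add.assoc add.commute)
      qed (simp add: kl)
      ultimately show ?thesis by (rule sat)
    qed
  qed
  have "Poly_Mapping.keys h \<subseteq> sat_at s"
    using up stable \<open>r \<noteq> s\<close> order_trans[OF keys sub]
    by (rule keys_subset_if_diff_times_keys_subset)
  moreover have "Poly_Mapping.keys ((Var s - Var r) * h) \<subseteq> U"
  proof -
    have "(Var s - Var r) * h = - ((Var r - Var s) * h)"
      by (simp add: algebra_simps)
    then show ?thesis using keys by simp
  qed
  from up stable \<open>r \<noteq> s\<close>[symmetric] order_trans[OF this sub]
  have "Poly_Mapping.keys h \<subseteq> sat_at r"
    by (rule keys_subset_if_diff_times_keys_subset)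
  ultimately show ?thesis
    using inter unfolding sat_at_def by blast
qed


section \<open>Splicing two isotone maps\<close>

text \<open>The number of hits of \<open>v\<close> is the exponent of the variable \<open>v\<close> in the image of the generator
  \<open>\<Prod>p\<in>P. x\<^bsub>p,\<phi>(p)\<^esub>\<close> under the substitution \<open>\<rho>\<close>.\<close>

definition hits :: "'p set \<Rightarrow> ('p \<times> nat \<Rightarrow> 'c) \<Rightarrow> ('p \<Rightarrow> nat) \<Rightarrow> 'c \<Rightarrow> 'p set" where
  "hits P \<rho> \<phi> v = {p \<in> P. \<rho> (p, \<phi> p) = v}"

lemma left_strict_chain_fibersD:
  assumes "left_strict_chain_fibers P n R \<psi>" "\<psi> \<in> P \<times> {1..n} \<rightarrow> R"
    and "(p, i) \<in> P \<times> {1..n}" "(q, j) \<in> P \<times> {1..n}" "\<psi> (p, i) = \<psi> (q, j)"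
  shows "p = q \<and> i = j \<or> p < q \<and> j \<le> i \<or> q < p \<and> i \<le> j"
proof -
  let ?C = "{a \<in> P \<times> {1..n}. \<psi> a = \<psi> (p, i)}" and ?le = "rel_prod (\<le>) (\<ge>)"
  have "left_strict_chain (\<le>) (\<ge>) ?C"
    using assms(1,2,3) unfolding left_strict_chain_fibers_def by blast
  then have chain: "Complete_Partial_Order.chain ?le ?C"
    and strict: "\<forall>x\<in>?C. \<forall>y\<in>?C. ?le x y \<and> x \<noteq> y \<longrightarrow> fst x \<le> fst y \<and> fst x \<noteq> fst y"
    unfolding left_strict_chain_def case_prod_beta' prod.collapse by (rule conjunct1, rule conjunct2)
  have C: "(p, i) \<in> ?C" "(q, j) \<in> ?C"
    using assms(3-5) by simp_all
  note strictD = bspec[OF bspec[OF strict]]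
  show ?thesis
    using chainD[OF chain C] strictD[OF C] strictD[OF C(2) C(1)] by (auto simp: less_le)
qed

text \<open>The minimum of two maps in \<open>J\<close> stays isotone when it is raised back to \<open>\<phi>\<close> on an upper set, and
  it stays in \<open>J\<close> because it lies below \<open>\<phi>\<close>.\<close>

lemma splice_in_poset_ideal:
  assumes J: "poset_ideal (pointwise_le P) (isotone_maps P n) J" and "\<phi> \<in> J" "\<chi> \<in> J"
  shows "(\<lambda>p. if q \<le> p then \<phi> p else min (\<phi> p) (\<chi> p)) \<in> J" (is "?\<omega> \<in> J")
proof -
  have iso: "\<phi> \<in> isotone_maps P n" "\<chi> \<in> isotone_maps P n"
    using assms by (auto simp: poset_ideal_def)
  have "?\<omega> \<in> P \<rightarrow>\<^sub>E {1..n}"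
    using iso by (auto simp: isotone_maps_def PiE_def Pi_def extensional_def)
  moreover have "monotone_on P (\<le>) (\<le>) ?\<omega>"
  proof (rule monotone_onI)
    fix x y assume xy: "x \<in> P" "y \<in> P" "x \<le> y"
    then have "\<phi> x \<le> \<phi> y" "\<chi> x \<le> \<chi> y"
      using iso by (auto simp: isotone_maps_def monotone_on_def)
    then show "?\<omega> x \<le> ?\<omega> y"
      using xy(3) by (auto simp: min_def)
  qed
  ultimately have "?\<omega> \<in> isotone_maps P n"
    by (simp add: isotone_maps_def)
  moreover have "pointwise_le P ?\<omega> \<phi>"
    by (simp add: pointwise_le_def)
  ultimately show ?thesis
    using J \<open>\<phi> \<in> J\<close> by (auto simp: poset_ideal_def)
qed

text \<open>The fibers of \<open>\<rho>\<close> refine those of \<open>\<psi>\<close>: in the quotient by an initial segment of the basis, only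
  some of the variables in a fiber of \<open>\<psi>\<close> have been identified.\<close>

locale split_fibers =
  fixes P :: "'p::order set" and n :: nat and R :: "'r set" and \<psi> :: "'p \<times> nat \<Rightarrow> 'r"
    and J :: "('p \<Rightarrow> nat) set" and \<rho> :: "'p \<times> nat \<Rightarrow> 'c"
  assumes finite_P: "finite P"
    and \<psi>_range: "\<psi> \<in> P \<times> {1..n} \<rightarrow> R"
    and fibers: "left_strict_chain_fibers P n R \<psi>"
    and poset_ideal_J: "poset_ideal (pointwise_le P) (isotone_maps P n) J"
    and \<psi>_eq: "\<And>a b. a \<in> P \<times> {1..n} \<Longrightarrow> b \<in> P \<times> {1..n} \<Longrightarrow> \<rho> a = \<rho> b \<Longrightarrow> \<psi> a = \<psi> b"
begin

lemma J_range: "\<phi> \<in> J \<Longrightarrow> p \<in> P \<Longrightarrow> (p, \<phi> p) \<in> P \<times> {1..n}"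
  using poset_ideal_J by (fastforce simp: poset_ideal_def isotone_maps_def)

lemma J_mono: "\<phi> \<in> J \<Longrightarrow> p \<in> P \<Longrightarrow> q \<in> P \<Longrightarrow> p \<le> q \<Longrightarrow> \<phi> p \<le> \<phi> q"
  using poset_ideal_J by (fastforce simp: poset_ideal_def isotone_maps_def monotone_on_def)

lemma finite_hits [simp]: "finite (hits P \<rho> \<phi> v)"
  using finite_P by (simp add: hits_def)

text \<open>A class of \<open>\<rho>\<close> is a left strict chain, on which the level does not increase with \<open>p\<close>, while isotone
  maps do not decrease. Suppose \<open>x\<close> is hit by the splice through \<open>\<chi>\<close> alone and \<open>y\<close> through \<open>\<phi>\<close> alone.
  Then \<open>\<chi> x < \<phi> x\<close>, \<open>x\<close> is not above \<open>q\<close>, and either \<open>y\<close> is above \<open>q\<close> or \<open>\<phi> y < \<chi> y\<close>; this excludes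
  \<open>x = y\<close>, and whichever of the two is the smaller, it contradicts monotonicity.\<close>

lemma hits_splice:
  fixes q
  defines "\<omega> \<equiv> \<lambda>\<phi> \<chi> p. if q \<le> p then \<phi> p else min (\<phi> p) (\<chi> p)"
  assumes "\<phi> \<in> J" "\<chi> \<in> J"
  shows "hits P \<rho> (\<omega> \<phi> \<chi>) v \<subseteq> hits P \<rho> \<phi> v \<or> hits P \<rho> (\<omega> \<phi> \<chi>) v \<subseteq> hits P \<rho> \<chi> v"
proof (rule ccontr)
  assume "\<not> ?thesis"
  then obtain x y where x: "x \<in> hits P \<rho> (\<omega> \<phi> \<chi>) v" "x \<notin> hits P \<rho> \<phi> v"
    and y: "y \<in> hits P \<rho> (\<omega> \<phi> \<chi>) v" "y \<notin> hits P \<rho> \<chi> v"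
    by blast
  have P: "x \<in> P" "y \<in> P"
    using x y by (auto simp: hits_def)
  have \<omega>: "\<omega> \<phi> \<chi> \<in> J"
    unfolding \<omega>_def using poset_ideal_J assms(2,3) by (rule splice_in_poset_ideal)
  have "\<rho> (x, \<omega> \<phi> \<chi> x) = \<rho> (y, \<omega> \<phi> \<chi> y)"
    using x y by (auto simp: hits_def)
  then have "\<psi> (x, \<omega> \<phi> \<chi> x) = \<psi> (y, \<omega> \<phi> \<chi> y)"
    using \<psi>_eq J_range[OF \<omega>] P by blast
  then have cases: "x = y \<or> x < y \<and> \<omega> \<phi> \<chi> y \<le> \<omega> \<phi> \<chi> x \<or> y < x \<and> \<omega> \<phi> \<chi> x \<le> \<omega> \<phi> \<chi> y"
    using left_strict_chain_fibersD[OF fibers \<psi>_range J_range[OF \<omega> P(1)] J_range[OF \<omega> P(2)]] by blast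
  have "\<omega> \<phi> \<chi> x \<noteq> \<phi> x" "\<omega> \<phi> \<chi> y \<noteq> \<chi> y"
    using x y by (auto simp: hits_def)
  then have xy: "\<not> q \<le> x" "\<omega> \<phi> \<chi> x = \<chi> x" "\<chi> x < \<phi> x"
    "\<omega> \<phi> \<chi> y = \<phi> y" "q \<le> y \<or> \<phi> y < \<chi> y"
    by (auto simp: \<omega>_def min_def split: if_splits)
  from cases show False
  proof (elim disjE conjE)
    assume "x = y" then show False using xy by auto
  next
    assume "x < y" "\<omega> \<phi> \<chi> y \<le> \<omega> \<phi> \<chi> x"
    then show False
      using J_mono[OF \<open>\<phi> \<in> J\<close> P(1) P(2)] xy by (auto dest: less_imp_le)
  next
    assume "y < x" "\<omega> \<phi> \<chi> x \<le> \<omega> \<phi> \<chi> y"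
    then show False
      using J_mono[OF \<open>\<chi> \<in> J\<close> P(2) P(1)] xy by (auto dest: less_imp_le order_trans)
  qed
qed

text \<open>Since \<open>p < q\<close> lie in one fiber of \<open>\<psi>\<close>, \<open>\<chi> p \<le> \<chi> q \<le> \<phi> p \<le> \<phi> q\<close>. Hence the minimum of both maps takes
  the value of \<open>\<chi>\<close> at \<open>p\<close>, which removes a hit of \<open>r\<close>, and raising it to \<open>\<phi>\<close> above \<open>q\<close> removes a hit
  of \<open>s\<close>. By the previous lemma the hits of each class are among those of one of the two maps, so these
  two removals suffice.\<close>

lemma splice_below:
  assumes \<phi>: "\<phi> \<in> J" "\<And>v. card (hits P \<rho> \<phi> v) \<le> u v + (if v = r then 1 else 0)"
    and \<chi>: "\<chi> \<in> J" "\<And>v. card (hits P \<rho> \<chi> v) \<le> u v + (if v = s then 1 else 0)"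
    and p: "p \<in> hits P \<rho> \<phi> r - hits P \<rho> \<chi> r"
    and q: "q \<in> hits P \<rho> \<chi> s - hits P \<rho> \<phi> s"
    and same: "\<psi> (p, \<phi> p) = \<psi> (q, \<chi> q)" and "r \<noteq> s" and "p < q"
  shows "\<exists>\<omega>\<in>J. \<forall>v. card (hits P \<rho> \<omega> v) \<le> u v"
proof -
  define \<omega> where "\<omega> x = (if q \<le> x then \<phi> x else min (\<phi> x) (\<chi> x))" for x
  have P: "p \<in> P" "q \<in> P"
    using p q by (auto simp: hits_def)
  have "\<chi> q \<le> \<phi> p"
    using left_strict_chain_fibersD[OF fibers \<psi>_range J_range[OF \<phi>(1) P(1)] J_range[OF \<chi>(1) P(2)] same]
      \<open>p < q\<close> by auto
  moreover have "\<phi> p \<noteq> \<chi> p" "\<phi> q \<noteq> \<chi> q"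
    using p q by (auto simp: hits_def)
  moreover have "\<phi> p \<le> \<phi> q" "\<chi> p \<le> \<chi> q"
    using J_mono P \<phi>(1) \<chi>(1) \<open>p < q\<close> by auto
  ultimately have "\<omega> p = \<chi> p" "\<omega> q = \<phi> q"
    using \<open>p < q\<close> by (auto simp: \<omega>_def)
  then have missed: "p \<notin> hits P \<rho> \<omega> r" "q \<notin> hits P \<rho> \<omega> s"
    using p q by (auto simp: hits_def)
  have "card (hits P \<rho> \<omega> v) \<le> u v" for v
  proof -
    have "hits P \<rho> \<omega> v \<subseteq> hits P \<rho> \<phi> v \<or> hits P \<rho> \<omega> v \<subseteq> hits P \<rho> \<chi> v"
      using hits_splice[OF \<phi>(1) \<chi>(1), of q v] by (simp add: \<omega>_def[abs_def])
    then show ?thesis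
    proof
      assume sub: "hits P \<rho> \<omega> v \<subseteq> hits P \<rho> \<phi> v"
      show ?thesis
      proof (cases "v = r")
        case True
        then have "hits P \<rho> \<omega> v \<subset> hits P \<rho> \<phi> v"
          using sub missed(1) p by blast
        then have "card (hits P \<rho> \<omega> v) < card (hits P \<rho> \<phi> v)"
          by (simp add: psubset_card_mono)
        then show ?thesis using \<phi>(2)[of v] True by simp
      next
        case False
        then show ?thesis
          using card_mono[OF _ sub] \<phi>(2)[of v] by simp
      qed
    next
      assume sub: "hits P \<rho> \<omega> v \<subseteq> hits P \<rho> \<chi> v"
      show ?thesis
      proof (cases "v = s")
        case True
        then have "hits P \<rho> \<omega> v \<subset> hits P \<rho> \<chi> v"
          using sub missed(2) q by blast
        then have "card (hits P \<rho> \<omega> v) < card (hits P \<rho> \<chi> v)"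
          by (simp add: psubset_card_mono)
        then show ?thesis using \<chi>(2)[of v] True by simp
      next
        case False
        then show ?thesis
          using card_mono[OF _ sub] \<chi>(2)[of v] by simp
      qed
    qed
  qed
  moreover have "\<omega> \<in> J"
    using splice_in_poset_ideal[OF poset_ideal_J \<phi>(1) \<chi>(1), of q] by (simp add: \<omega>_def[abs_def])
  ultimately show ?thesis by blast
qed

text \<open>The combinatorial core: if \<open>r u\<close> and \<open>s u\<close> both lie in the ideal of the image generators, then so
  does \<open>u\<close>. Unless one of the two maps already works, each hits its surplus variable at a place where
  the other does not. These two places are distinct and lie in one fiber, hence are comparable, and
  the statement is symmetric in the two maps.\<close>

lemma exists_below_if_exists_below_both:
  assumes \<phi>: "\<phi> \<in> J" "\<And>v. card (hits P \<rho> \<phi> v) \<le> u v + (if v = r then 1 else 0)"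
    and \<chi>: "\<chi> \<in> J" "\<And>v. card (hits P \<rho> \<chi> v) \<le> u v + (if v = s then 1 else 0)"
    and a: "a \<in> P \<times> {1..n}" "\<rho> a = r" and b: "b \<in> P \<times> {1..n}" "\<rho> b = s"
    and ab: "\<psi> a = \<psi> b" and "r \<noteq> s"
  shows "\<exists>\<omega>\<in>J. \<forall>v. card (hits P \<rho> \<omega> v) \<le> u v"
proof (cases "card (hits P \<rho> \<phi> r) \<le> u r \<or> card (hits P \<rho> \<chi> s) \<le> u s")
  case True
  have "\<forall>v. card (hits P \<rho> \<phi> v) \<le> u v" if "card (hits P \<rho> \<phi> r) \<le> u r"
    using that \<phi>(2) by (metis add_0_right)
  moreover have "\<forall>v. card (hits P \<rho> \<chi> v) \<le> u v" if "card (hits P \<rho> \<chi> s) \<le> u s"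
    using that \<chi>(2) by (metis add_0_right)
  ultimately show ?thesis
    using True \<phi>(1) \<chi>(1) by blast
next
  case False
  then have "card (hits P \<rho> \<chi> r) < card (hits P \<rho> \<phi> r)" "card (hits P \<rho> \<phi> s) < card (hits P \<rho> \<chi> s)"
    using \<phi>(2)[of s] \<chi>(2)[of r] \<open>r \<noteq> s\<close> by auto
  then have "\<not> hits P \<rho> \<phi> r \<subseteq> hits P \<rho> \<chi> r" "\<not> hits P \<rho> \<chi> s \<subseteq> hits P \<rho> \<phi> s"
    using card_mono[of "hits P \<rho> \<chi> r" "hits P \<rho> \<phi> r"] card_mono[of "hits P \<rho> \<phi> s" "hits P \<rho> \<chi> s"]
    by auto
  then obtain p q where p: "p \<in> hits P \<rho> \<phi> r - hits P \<rho> \<chi> r"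
    and q: "q \<in> hits P \<rho> \<chi> s - hits P \<rho> \<phi> s"
    by blast
  have pq: "(p, \<phi> p) \<in> P \<times> {1..n}" "(q, \<chi> q) \<in> P \<times> {1..n}"
    using p q J_range \<phi>(1) \<chi>(1) by (simp_all add: hits_def)
  have "\<psi> (p, \<phi> p) = \<psi> a" "\<psi> (q, \<chi> q) = \<psi> b"
    using p q a b pq by (auto simp: hits_def intro!: \<psi>_eq)
  then have same: "\<psi> (p, \<phi> p) = \<psi> (q, \<chi> q)"
    using ab by simp
  have "(p, \<phi> p) \<noteq> (q, \<chi> q)"
    using p q \<open>r \<noteq> s\<close> by (auto simp: hits_def)
  then consider "p < q" | "q < p"
    using left_strict_chain_fibersD[OF fibers \<psi>_range pq same] by auto
  then show ?thesis
    using splice_below[OF \<phi> \<chi> p q same \<open>r \<noteq> s\<close>]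
      splice_below[OF \<chi> \<phi> q p same[symmetric] \<open>r \<noteq> s\<close>[symmetric]] by cases blast+
qed

end


section \<open>Ideals of the polynomial ring\<close>

lemma ideal_poly_ringI:
  assumes sub: "I \<subseteq> carrier (poly_ring A)" and zero: "0 \<in> I"
    and add: "\<And>f g. f \<in> I \<Longrightarrow> g \<in> I \<Longrightarrow> f + g \<in> I"
    and mult: "\<And>f g. f \<in> I \<Longrightarrow> g \<in> carrier (poly_ring A) \<Longrightarrow> g * f \<in> I"
  shows "ideal I (poly_ring A :: ('v, 'k::field) mpoly ring)"
proof -
  interpret R: cring "poly_ring A :: ('v, 'k) mpoly ring"
    by (rule poly_ring_cring)
  have "\<ominus>\<^bsub>poly_ring A\<^esub> f \<in> I" if "f \<in> I" for f
  proof -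
    have "f \<in> carrier (poly_ring A)"
      using that sub by blast
    then have "\<ominus>\<^bsub>poly_ring A\<^esub> f = (\<ominus>\<^bsub>poly_ring A\<^esub> \<one>\<^bsub>poly_ring A\<^esub>) \<otimes>\<^bsub>poly_ring A\<^esub> f"
      by (simp only: R.l_minus R.one_closed R.l_one)
    then show ?thesis
      using mult[OF that, of "\<ominus>\<^bsub>poly_ring A\<^esub> \<one>\<^bsub>poly_ring A\<^esub>"] by (simp del: poly_ring_sel(2))
  qed
  then have "subgroup I (add_monoid (poly_ring A))"
    using sub zero add by (intro R.add.subgroupI) (auto simp: a_inv_def)
  then show ?thesis
    using mult sub by (intro idealI R.ring_axioms) (auto simp: mult.commute)
qed

lemma ideal_poly_ringD:
  assumes "ideal K (poly_ring A :: ('v, 'k::field) mpoly ring)"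
  shows "K \<subseteq> carrier (poly_ring A)" "0 \<in> K"
    and "f \<in> K \<Longrightarrow> g \<in> K \<Longrightarrow> f + g \<in> K"
    and "f \<in> K \<Longrightarrow> g \<in> carrier (poly_ring A) \<Longrightarrow> g * f \<in> K"
    and "f \<in> K \<Longrightarrow> g \<in> K \<Longrightarrow> f - g \<in> K"
proof -
  interpret ideal K "poly_ring A" by (rule assms)
  show "K \<subseteq> carrier (poly_ring A)"
    by (rule a_subset)
  show "0 \<in> K"
    using additive_subgroup.zero_closed[OF additive_subgroup_axioms] by simp
  show add: "f + g \<in> K" if "f \<in> K" "g \<in> K" for f g
    using additive_subgroup.a_closed[OF additive_subgroup_axioms that] by simp
  show mult: "g * f \<in> K" if "f \<in> K" "g \<in> carrier (poly_ring A)" for f g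
    using I_l_closed[OF that] by simp
  have "- 1 \<in> carrier (poly_ring A :: ('v, 'k) mpoly ring)"
    by (simp add: poly_ring_def)
  then show "f - g \<in> K" if "f \<in> K" "g \<in> K"
    using add[OF that(1) mult[OF that(2), of "- 1"]] by simp
qed

lemma single_in_poly_ring:
  "Poly_Mapping.keys m \<subseteq> A \<Longrightarrow> Poly_Mapping.single m c \<in> carrier (poly_ring A)"
  by (simp add: poly_ring_def)

lemma Var_in_poly_ring: "v \<in> A \<Longrightarrow> Var v \<in> carrier (poly_ring A)"
  by (simp add: poly_ring_def Var_def)

lemma subst_vars_in_poly_ring:
  assumes \<rho>: "\<rho> \<in> A \<rightarrow> A" and g: "g \<in> carrier (poly_ring A)"
  shows "subst_vars \<rho> g \<in> carrier (poly_ring A)"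
proof -
  have "Poly_Mapping.keys m \<subseteq> A" if m: "m \<in> Poly_Mapping.keys (subst_vars \<rho> g)" for m
  proof -
    obtain m' where m': "m' \<in> Poly_Mapping.keys g" "m = push \<rho> m'"
      using m keys_push[of "push \<rho>" g] by blast
    then have "Poly_Mapping.keys m' \<subseteq> A"
      using g by (simp add: poly_ring_def)
    then show ?thesis
      using keys_push[of \<rho> m'] \<rho> m'(2) by blast
  qed
  then show ?thesis
    by (simp add: poly_ring_def)
qed

lemma ideal_sum_mem:
  assumes K: "ideal K (poly_ring A :: ('v, 'k::field) mpoly ring)"
    and "\<And>x. x \<in> X \<Longrightarrow> f x \<in> K"
  shows "sum f X \<in> K"
  using assms(2)
  by (induction X rule: infinite_finite_induct) (simp_all add: ideal_poly_ringD[OF K])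

lemma subset_mpoly_span_in_ideal:
  assumes K: "ideal K (poly_ring A :: ('v, 'k::field) mpoly ring)" and "S \<subseteq> K"
  shows "mpoly.span S \<subseteq> K"
proof (rule mpoly.span_minimal[OF \<open>S \<subseteq> K\<close>])
  have "mpoly_scale c f \<in> K" if "f \<in> K" for c f
    unfolding mpoly_scale_def using that
    by (rule ideal_poly_ringD(4)[OF K]) (simp add: single_in_poly_ring)
  then show "mpoly.subspace K"
    unfolding mpoly.subspace_def using ideal_poly_ringD[OF K] by blast
qed

lemma ideal_congruence_mult:
  assumes K: "ideal K (poly_ring A :: ('v, 'k::field) mpoly ring)"
    and "f - f' \<in> K" "g - g' \<in> K" "f \<in> carrier (poly_ring A)" "g' \<in> carrier (poly_ring A)"
  shows "f * g - f' * g' \<in> K"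
proof -
  have "f * g - f' * g' = f * (g - g') + g' * (f - f')"
    by (simp add: algebra_simps)
  also have "\<dots> \<in> K"
    by (rule ideal_poly_ringD(3)[OF K]) (rule ideal_poly_ringD(4)[OF K], fact+)+
  finally show ?thesis .
qed

text \<open>Modulo \<open>K\<close>, substituting congruent variables changes nothing: congruence is compatible with
  products, hence holds for powers of variables, monomials and their linear combinations.\<close>

lemma diff_subst_vars_mem:
  fixes K :: "('v, 'k::field) mpoly set"
  assumes K: "ideal K (poly_ring A)"
    and \<rho>: "\<rho> \<in> A \<rightarrow> A" and vars: "\<And>v. v \<in> A \<Longrightarrow> Var v - Var (\<rho> v) \<in> K"
    and g: "g \<in> carrier (poly_ring A)"
  shows "g - subst_vars \<rho> g \<in> K"
proof -
  let ?x = "\<lambda>m. Poly_Mapping.single m (1::'k)"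
  let ?v = "\<lambda>v k. Poly_Mapping.single v (k::nat)"
  have var_power: "?x (?v v k) - ?x (?v (\<rho> v) k) \<in> K" if v: "v \<in> A" for v k
  proof (induction k)
    case 0
    show ?case by (simp add: ideal_poly_ringD[OF K])
  next
    case (Suc k)
    have "?x (?v w (Suc k)) = Var w * ?x (?v w k)" for w :: 'v
      by (simp add: Var_def mult_single flip: single_add)
    then show ?case
      using ideal_congruence_mult[OF K vars[OF v] Suc Var_in_poly_ring[OF v]] v \<rho>
      by (simp add: Pi_iff single_in_poly_ring)
  qed
  have monomials: "?x (\<Sum>v\<in>V. ?v v (e v)) - ?x (\<Sum>v\<in>V. ?v (\<rho> v) (e v)) \<in> K"
    if "finite V" "V \<subseteq> A" for V e
    using that
  proof (induction V)
    case empty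
    show ?case by (simp add: ideal_poly_ringD[OF K])
  next
    case (insert v V)
    have prod: "?x (m + m') = ?x m * ?x m'" for m m' :: "'v \<Rightarrow>\<^sub>0 nat"
      by (simp add: mult_single)
    have "Poly_Mapping.keys (\<Sum>v\<in>V. ?v (\<rho> v) (e v)) \<subseteq> A"
      using keys_sum[of "\<lambda>v. ?v (\<rho> v) (e v)" V] insert.prems \<rho> by (auto split: if_splits)
    moreover have "Poly_Mapping.keys (?v v (e v)) \<subseteq> A"
      using insert.prems by simp
    moreover have "v \<in> A" "V \<subseteq> A"
      using insert.prems by auto
    ultimately show ?case
      unfolding sum.insert[OF insert.hyps] prod
      by (intro ideal_congruence_mult[OF K] single_in_poly_ring var_power insert.IH)
  qed
  have "g - subst_vars \<rho> g =
      (\<Sum>m\<in>Poly_Mapping.keys g. Poly_Mapping.single m (Poly_Mapping.lookup g m)) - subst_vars \<rho> g"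
    by (simp add: sum_of_singles)
  also have "\<dots> = (\<Sum>m\<in>Poly_Mapping.keys g.
      Poly_Mapping.single 0 (Poly_Mapping.lookup g m) * (?x m - ?x (push \<rho> m)))"
    unfolding push_def[of "push \<rho>" g]
    by (simp add: right_diff_distrib mult_single flip: sum_subtractf)
  also have "\<dots> \<in> K"
  proof (rule ideal_sum_mem[OF K])
    fix m assume m: "m \<in> Poly_Mapping.keys g"
    then have "?x m - ?x (push \<rho> m) \<in> K"
      using monomials[of "Poly_Mapping.keys m" "Poly_Mapping.lookup m"] g
      by (simp add: sum_of_singles push_def poly_ring_def)
    then show "Poly_Mapping.single 0 (Poly_Mapping.lookup g m) * (?x m - ?x (push \<rho> m)) \<in> K"
      by (rule ideal_poly_ringD(4)[OF K]) (simp add: single_in_poly_ring)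
  qed
  finally show ?thesis .
qed

lemma ideal_subst_vars_monomials:
  assumes "up_closed U"
  shows "ideal {g \<in> carrier (poly_ring A). Poly_Mapping.keys (subst_vars \<rho> g) \<subseteq> U}
    (poly_ring A :: ('v, 'k::field) mpoly ring)" (is "ideal ?I _")
proof -
  interpret R: cring "poly_ring A :: ('v, 'k) mpoly ring"
    by (rule poly_ring_cring)
  show ?thesis
  proof (rule ideal_poly_ringI)
    fix f g assume f: "f \<in> ?I" and g: "g \<in> ?I"
    have "Poly_Mapping.keys (subst_vars \<rho> (f + g)) \<subseteq> U"
      using f g Poly_Mapping.keys_add[of "subst_vars \<rho> f" "subst_vars \<rho> g"] by (auto simp: push_add)
    then show "f + g \<in> ?I"
      using f g R.a_closed[of f g] by simp
  next
    fix f g :: "('v, 'k) mpoly" assume f: "f \<in> ?I" and g: "g \<in> carrier (poly_ring A)"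
    have "Poly_Mapping.keys (subst_vars \<rho> (g * f)) \<subseteq> U"
      using keys_mult[of "subst_vars \<rho> g" "subst_vars \<rho> f"] f assms
      unfolding subst_vars_mult up_closed_def by (fastforce simp: add.commute)
    then show "g * f \<in> ?I"
      using f g R.m_closed[of g f] by simp
  qed (auto simp: poly_ring_def)
qed


section \<open>The image of the co-letterplace ideal\<close>

definition map_monomial :: "'p set \<Rightarrow> ('p \<times> nat \<Rightarrow> 'c) \<Rightarrow> ('p \<Rightarrow> nat) \<Rightarrow> 'c \<Rightarrow>\<^sub>0 nat" where
  "map_monomial P \<rho> \<phi> = (\<Sum>p\<in>P. Poly_Mapping.single (\<rho> (p, \<phi> p)) 1)"

text \<open>The monomials divisible by the image of some generator.\<close>

definition image_monomials ::
    "'p set \<Rightarrow> ('p \<times> nat \<Rightarrow> 'c) \<Rightarrow> ('p \<Rightarrow> nat) set \<Rightarrow> ('c \<Rightarrow>\<^sub>0 nat) set" where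
  "image_monomials P \<rho> J =
     {u. \<exists>\<phi>\<in>J. \<forall>v. card (hits P \<rho> \<phi> v) \<le> Poly_Mapping.lookup u v}"

lemma prod_Var: "(\<Prod>p\<in>P. Var (f p)) = Poly_Mapping.single (\<Sum>p\<in>P. Poly_Mapping.single (f p) 1) 1"
  by (induction P rule: infinite_finite_induct) (simp_all add: Var_def mult_single)

lemma lookup_map_monomial:
  assumes "finite P"
  shows "Poly_Mapping.lookup (map_monomial P \<rho> \<phi>) v = card (hits P \<rho> \<phi> v)"
  using assms
  by (simp add: map_monomial_def hits_def lookup_sum lookup_single when_def flip: sum.inter_filter)

lemma subst_vars_map_prod:
  "subst_vars \<rho> (\<Prod>p\<in>P. Var (p, \<phi> p)) = Poly_Mapping.single (map_monomial P \<rho> \<phi>) 1"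
  by (simp add: prod_Var push_sum map_monomial_def)

lemma up_closed_image_monomials: "up_closed (image_monomials P \<rho> J)"
  unfolding up_closed_def image_monomials_def by (auto simp: lookup_add intro: trans_le_add1)

lemma add_single_mem_image_monomials_iff:
  "u + Poly_Mapping.single r 1 \<in> image_monomials P \<rho> J \<longleftrightarrow>
     (\<exists>\<phi>\<in>J. \<forall>v. card (hits P \<rho> \<phi> v) \<le> Poly_Mapping.lookup u v + (if v = r then 1 else 0))"
  by (simp add: image_monomials_def lookup_add lookup_single when_def eq_commute[of r])

lemma image_monomials_split:
  assumes "finite P" "u \<in> image_monomials P \<rho> J"
  obtains \<phi> w where "\<phi> \<in> J" "u = w + map_monomial P \<rho> \<phi>"
proof -
  obtain \<phi> where \<phi>: "\<phi> \<in> J" "\<And>v. card (hits P \<rho> \<phi> v) \<le> Poly_Mapping.lookup u v"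
    using assms(2) by (auto simp: image_monomials_def)
  have "u = (u - map_monomial P \<rho> \<phi>) + map_monomial P \<rho> \<phi>"
    by (rule poly_mapping_eqI)
      (simp add: lookup_add minus_poly_mapping.rep_eq lookup_map_monomial[OF \<open>finite P\<close>] \<phi>(2))
  then show ?thesis
    using \<phi>(1) that by blast
qed

lemma coletterplace_generator_in_poly_ring:
  assumes "\<phi> \<in> isotone_maps P n"
  shows "(\<Prod>p\<in>P. Var (p, \<phi> p)) \<in> carrier (poly_ring (P \<times> {1..n}))"
proof -
  have "(p, \<phi> p) \<in> P \<times> {1..n}" if "p \<in> P" for p
    using that assms unfolding isotone_maps_def by fastforce
  then have "Poly_Mapping.keys (\<Sum>p\<in>P. Poly_Mapping.single (p, \<phi> p) (1::nat)) \<subseteq> P \<times> {1..n}"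
    using keys_sum[of "\<lambda>p. Poly_Mapping.single (p, \<phi> p) (1::nat)" P] by auto
  then show ?thesis
    unfolding prod_Var by (rule single_in_poly_ring)
qed

lemma ideal_coletterplace_ideal:
  assumes "J \<subseteq> isotone_maps P n"
  shows "ideal (coletterplace_ideal P n J) (poly_ring (P \<times> {1..n}))"
    and "(\<lambda>\<phi>. \<Prod>p\<in>P. Var (p, \<phi> p)) ` J \<subseteq> coletterplace_ideal P n J"
proof -
  have gen: "(\<lambda>\<phi>. \<Prod>p\<in>P. Var (p, \<phi> p)) ` J \<subseteq> carrier (poly_ring (P \<times> {1..n}))"
    using assms coletterplace_generator_in_poly_ring by blast
  interpret R: cring "poly_ring (P \<times> {1..n})"
    by (rule poly_ring_cring)
  show "ideal (coletterplace_ideal P n J) (poly_ring (P \<times> {1..n}))"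
    and "(\<lambda>\<phi>. \<Prod>p\<in>P. Var (p, \<phi> p)) ` J \<subseteq> coletterplace_ideal P n J"
    unfolding coletterplace_ideal_def using gen by (rule R.genideal_ideal, rule R.genideal_self)
qed

text \<open>Dividing by \<open>E\<close> amounts to identifying variables along \<open>\<rho>\<close>, after which the co-letterplace
  ideal becomes the monomial ideal of the image generators. The set described on the
  right-hand side is an ideal that contains all generators of the left-hand side; conversely \<open>g\<close> is
  congruent to its image, each monomial of which is a multiple of an image generator, and that is
  congruent to a generator.\<close>

lemma genideal_coletterplace_iff:
  fixes P :: "'p::order set" and n :: nat and J :: "('p \<Rightarrow> nat) set"
    and E :: "('p \<times> nat, 'k::field) mpoly set"
  defines "A \<equiv> P \<times> {1..n}"
  defines "K \<equiv> Idl\<^bsub>poly_ring A\<^esub> (coletterplace_ideal P n J \<union> E)"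
  assumes "finite P" and J: "J \<subseteq> isotone_maps P n"
    and E: "E \<subseteq> carrier (poly_ring A)" "\<And>b. b \<in> E \<Longrightarrow> subst_vars \<rho> b = 0"
    and \<rho>: "\<rho> \<in> A \<rightarrow> A" "\<And>v. v \<in> A \<Longrightarrow> Var v - Var (\<rho> v) \<in> mpoly.span E"
    and g: "g \<in> carrier (poly_ring A)"
  shows "g \<in> K \<longleftrightarrow> Poly_Mapping.keys (subst_vars \<rho> g) \<subseteq> image_monomials P \<rho> J"
proof -
  interpret R: cring "poly_ring A :: ('p \<times> nat, 'k) mpoly ring"
    by (rule poly_ring_cring)
  let ?L = "coletterplace_ideal P n J :: ('p \<times> nat, 'k) mpoly set"
  let ?gen = "\<lambda>\<phi>. \<Prod>p\<in>P. Var (p, \<phi> p) :: ('p \<times> nat, 'k) mpoly"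
  have gen: "?gen \<phi> \<in> carrier (poly_ring A)" if "\<phi> \<in> J" for \<phi>
    using that J coletterplace_generator_in_poly_ring unfolding A_def by blast
  have L: "ideal ?L (poly_ring A)" "?gen ` J \<subseteq> ?L"
    unfolding A_def using J by (rule ideal_coletterplace_ideal)+
  have "?L \<union> E \<subseteq> carrier (poly_ring A)"
    using E(1) ideal_poly_ringD(1)[OF L(1)] by blast
  then have K: "ideal K (poly_ring A)" "?L \<union> E \<subseteq> K"
    unfolding K_def by (rule R.genideal_ideal, rule R.genideal_self)
  have "mpoly.span E \<subseteq> K"
    using K by (intro subset_mpoly_span_in_ideal[OF K(1)]) blast
  then have diff: "f - subst_vars \<rho> f \<in> K" if "f \<in> carrier (poly_ring A)" for f
    using \<rho> that by (intro diff_subst_vars_mem[OF K(1)]) auto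
  show ?thesis
  proof
    let ?I = "{g \<in> carrier (poly_ring A). Poly_Mapping.keys (subst_vars \<rho> g) \<subseteq> image_monomials P \<rho> J}"
    have I: "ideal ?I (poly_ring A :: ('p \<times> nat, 'k) mpoly ring)"
      by (rule ideal_subst_vars_monomials) (rule up_closed_image_monomials)
    have "?gen ` J \<subseteq> ?I"
      using gen \<open>finite P\<close>
      by (auto simp: subst_vars_map_prod image_monomials_def lookup_map_monomial)
    then have "?L \<subseteq> ?I"
      unfolding coletterplace_ideal_def A_def[symmetric] by (rule R.genideal_minimal[OF I])
    moreover have "E \<subseteq> ?I"
      using E by auto
    ultimately have "K \<subseteq> ?I"
      unfolding K_def by (intro R.genideal_minimal[OF I]) blast
    then show "Poly_Mapping.keys (subst_vars \<rho> g) \<subseteq> image_monomials P \<rho> J" if "g \<in> K"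
      using that by blast
  next
    assume keys: "Poly_Mapping.keys (subst_vars \<rho> g) \<subseteq> image_monomials P \<rho> J"
    have "(\<Sum>u\<in>Poly_Mapping.keys (subst_vars \<rho> g).
        Poly_Mapping.single u (Poly_Mapping.lookup (subst_vars \<rho> g) u)) \<in> K"
    proof (rule ideal_sum_mem[OF K(1)])
      fix u assume u: "u \<in> Poly_Mapping.keys (subst_vars \<rho> g)"
      let ?c = "Poly_Mapping.lookup (subst_vars \<rho> g) u"
      obtain \<phi> w where \<phi>: "\<phi> \<in> J" and w: "u = w + map_monomial P \<rho> \<phi>"
        using image_monomials_split[OF \<open>finite P\<close>] u keys by blast
      have "?gen \<phi> \<in> K"
        using \<phi> L(2) K(2) by blast
      moreover have "?gen \<phi> - Poly_Mapping.single (map_monomial P \<rho> \<phi>) 1 \<in> K"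
        using diff[OF gen[OF \<phi>]] by (simp only: subst_vars_map_prod)
      ultimately have "Poly_Mapping.single (map_monomial P \<rho> \<phi>) 1 \<in> K"
        using ideal_poly_ringD(5)[OF K(1)] by fastforce
      moreover have "Poly_Mapping.keys w \<subseteq> A"
      proof -
        have "Poly_Mapping.keys u \<subseteq> A"
          using subst_vars_in_poly_ring[OF \<rho>(1) g] u by (simp add: poly_ring_def)
        then show ?thesis
          unfolding w by (auto simp: in_keys_iff lookup_add)
      qed
      ultimately have "Poly_Mapping.single w ?c * Poly_Mapping.single (map_monomial P \<rho> \<phi>) 1 \<in> K"
        by (intro ideal_poly_ringD(4)[OF K(1)] single_in_poly_ring)
      then show "Poly_Mapping.single u ?c \<in> K"
        by (simp only: mult_single mult_1_right flip: w)
    qed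
    then have "subst_vars \<rho> g \<in> K"
      by (simp only: sum_of_singles)
    then have "(g - subst_vars \<rho> g) + subst_vars \<rho> g \<in> K"
      using diff[OF g] by (intro ideal_poly_ringD(3)[OF K(1)])
    then show "g \<in> K" by simp
  qed
qed


section \<open>Regular sequences in a quotient ring\<close>

text \<open>An instance of the correspondence between the ideals of the quotient by \<open>I\<close> and the ideals
  containing \<open>I\<close>.\<close>

lemma (in cring) mem_genideal_quotient_iff:
  assumes I: "ideal I R" and F: "F \<subseteq> carrier R" and g: "g \<in> carrier R"
  shows "I +> g \<in> Idl\<^bsub>R Quot I\<^esub> ((+>) I ` F) \<longleftrightarrow> g \<in> Idl (I \<union> F)" (is "_ \<in> ?K \<longleftrightarrow> _ \<in> ?L")
proof -
  interpret I: ideal I R by (rule I)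
  interpret Q: ring_hom_ring R "R Quot I" "(+>) I" by (rule I.rcos_ring_hom_ring)
  have IF: "I \<union> F \<subseteq> carrier R"
    using F I.a_subset by blast
  then have L: "ideal ?L R" "I \<union> F \<subseteq> ?L"
    by (rule genideal_ideal, rule genideal_self)
  have imF: "(+>) I ` F \<subseteq> carrier (R Quot I)"
    using F by auto
  then have K: "ideal ?K (R Quot I)" "(+>) I ` F \<subseteq> ?K"
    by (rule Q.S.genideal_ideal, rule Q.S.genideal_self)
  show ?thesis
  proof
    assume "I +> g \<in> ?K"
    moreover have "?K \<subseteq> (+>) I ` ?L"
      using L by (intro Q.S.genideal_minimal ring_ideal_imp_quot_ideal I) auto
    ultimately obtain l where l: "l \<in> ?L" "I +> g = I +> l"
      by auto
    have lc: "l \<in> carrier R"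
      using ideal.Icarr[OF L(1) l(1)] .
    have "g \<ominus> l \<in> ?L"
      using quotient_eq_iff_same_a_r_cos[OF I g lc] l(2) L(2) by auto
    then have "g \<ominus> l \<oplus> l \<in> ?L"
      using L(1) l(1) by (simp add: additive_subgroup.a_closed ideal.axioms(1))
    then show "g \<in> ?L"
      using g lc by (simp add: minus_eq a_assoc l_neg)
  next
    assume "g \<in> ?L"
    moreover have "?L \<subseteq> {r \<in> carrier R. I +> r \<in> ?K}"
    proof (rule genideal_minimal)
      show "ideal {r \<in> carrier R. I +> r \<in> ?K} R"
        by (rule Q.ideal_vimage) (rule K)
      have "I +> x \<in> ?K" if "x \<in> I" for x
      proof -
        have "I +> x = \<zero>\<^bsub>R Quot I\<^esub>"
          unfolding a_rcos_zero[OF I that] by (simp only: FactRing_def ring.simps)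
        then show ?thesis
          by (simp only: additive_subgroup.zero_closed[OF ideal.axioms(1)[OF K(1)]])
      qed
      then show "I \<union> F \<subseteq> {r \<in> carrier R. I +> r \<in> ?K}"
        using IF K(2) by auto
    qed
    ultimately show "I +> g \<in> ?K" by blast
  qed
qed

lemma (in ring) carrier_quotient: "carrier (R Quot I) = (+>) I ` carrier R"
  by (simp add: FactRing_def A_RCOSETS_def') blast

lemma (in cring) nonzerodivisor_quotient_iff:
  assumes K: "ideal K R" and b: "b \<in> carrier R"
  shows "nonzerodivisor (R Quot K) (K +> b) \<longleftrightarrow> (\<forall>f\<in>carrier R. b \<otimes> f \<in> K \<longrightarrow> f \<in> K)"
proof -
  interpret K: ideal K R by (rule K)
  interpret Q: ring_hom_ring R "R Quot K" "(+>) K" by (rule K.rcos_ring_hom_ring)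
  have zero: "K +> f = \<zero>\<^bsub>R Quot K\<^esub> \<longleftrightarrow> f \<in> K" if "f \<in> carrier R" for f
  proof -
    have "\<zero>\<^bsub>R Quot K\<^esub> = K +> \<zero>"
      by simp
    then show ?thesis
      using quotient_eq_iff_same_a_r_cos[OF K that zero_closed] that by (simp add: minus_eq)
  qed
  show ?thesis
    using b unfolding nonzerodivisor_def carrier_quotient ball_simps
    by (simp add: zero flip: Q.hom_mult)
qed

text \<open>Regularity in the quotient by \<open>I\<close> is a statement about ideals of the ring itself that contain
  \<open>I\<close>, which avoids iterated quotients.\<close>

lemma (in cring) regular_sequence_quotientI:
  assumes I: "ideal I R" and bs: "set bs \<subseteq> carrier R"
    and nzd: "\<And>i f. i < length bs \<Longrightarrow> f \<in> carrier R \<Longrightarrow>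
      bs ! i \<otimes> f \<in> Idl (I \<union> set (take i bs)) \<Longrightarrow> f \<in> Idl (I \<union> set (take i bs))"
  shows "regular_sequence (R Quot I) (map ((+>) I) bs)"
proof -
  interpret I: ideal I R by (rule I)
  interpret Q: ring_hom_cring R "R Quot I" "(+>) I"
    by (rule I.rcos_ring_hom_cring) (rule cring_axioms)
  show ?thesis
    unfolding regular_sequence_def Let_def
  proof (intro conjI allI impI)
    show "set (map ((+>) I) bs) \<subseteq> carrier (R Quot I)"
      using bs by auto
    fix i assume i: "i < length (map ((+>) I) bs)"
    have T: "set (take i bs) \<subseteq> carrier R"
      using bs set_take_subset by fast
    have b: "bs ! i \<in> carrier R"
      using i bs by (simp add: subset_iff)
    let ?K = "Idl\<^bsub>R Quot I\<^esub> ((+>) I ` set (take i bs))"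
    have K: "ideal ?K (R Quot I)"
      using T by (intro Q.S.genideal_ideal) auto
    have "nonzerodivisor (R Quot I Quot ?K) (?K +>\<^bsub>R Quot I\<^esub> (I +> bs ! i))"
    proof (subst Q.S.nonzerodivisor_quotient_iff[OF K], goal_cases)
      case 1 show ?case using b by simp
    next
      case 2
      have "f \<in> ?K" if f: "f \<in> carrier (R Quot I)" "(I +> bs ! i) \<otimes>\<^bsub>R Quot I\<^esub> f \<in> ?K" for f
      proof -
        obtain g where g: "g \<in> carrier R" "f = I +> g"
          using f(1) unfolding carrier_quotient by blast
        have "I +> (bs ! i \<otimes> g) \<in> ?K"
          using f(2) unfolding g(2) Q.hom_mult[OF b g(1)] .
        then have "bs ! i \<otimes> g \<in> Idl (I \<union> set (take i bs))"
          using mem_genideal_quotient_iff[OF I T m_closed[OF b g(1)]] by blast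
        then have "g \<in> Idl (I \<union> set (take i bs))"
          using nzd[of i g] i g(1) by simp
        then show ?thesis
          using mem_genideal_quotient_iff[OF I T g(1)] g(2) by blast
      qed
      then show ?case by blast
    qed
    then show "nonzerodivisor (R Quot I Quot Idl\<^bsub>R Quot I\<^esub> set (take i (map ((+>) I) bs)))
        (Idl\<^bsub>R Quot I\<^esub> set (take i (map ((+>) I) bs)) +>\<^bsub>R Quot I\<^esub> map ((+>) I) bs ! i)"
      using i by (simp add: take_map)
  qed
qed


section \<open>Identifying variables by a set of linear forms\<close>

text \<open>Two variables are identified by \<open>E\<close> when their difference is a linear combination of \<open>E\<close>; this is
  an equivalence relation because spans are closed under addition and subtraction. Defining the
  classes by the span rather than by chains of differences in \<open>E\<close> makes linear independence directly
  applicable.\<close>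

lemma exists_representatives:
  fixes E :: "('v, 'k::field) mpoly set"
  obtains \<rho> where "\<rho> \<in> A \<rightarrow> A"
    and "\<And>v. v \<in> A \<Longrightarrow> Var v - Var (\<rho> v) \<in> mpoly.span E"
    and "\<And>v w. v \<in> A \<Longrightarrow> w \<in> A \<Longrightarrow> Var v - Var w \<in> mpoly.span E \<Longrightarrow> \<rho> v = \<rho> w"
proof -
  define rel where "rel v w \<longleftrightarrow> w \<in> A \<and> Var v - Var w \<in> mpoly.span E" for v w :: 'v
  have refl: "rel v v" if "v \<in> A" for v
    using that by (simp add: rel_def mpoly.span_zero)
  have cong: "rel v = rel w" if "Var v - Var w \<in> mpoly.span E" for v w
  proof
    fix x
    have "(Var v - Var x) - (Var v - Var w) = (Var w - Var x :: ('v, 'k) mpoly)"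
      and "(Var w - Var x) + (Var v - Var w) = (Var v - Var x :: ('v, 'k) mpoly)"
      by simp_all
    then show "rel v x = rel w x"
      unfolding rel_def using that by (metis mpoly.span_add mpoly.span_diff)
  qed
  define \<rho> where "\<rho> v = Eps (rel v)" for v
  have rel: "rel v (\<rho> v)" if "v \<in> A" for v
    unfolding \<rho>_def by (rule someI) (rule refl[OF that])
  then show ?thesis
    using that[of \<rho>] cong by (auto simp: rel_def \<rho>_def)
qed

lemma eq_if_Var_diff_in_kernel:
  assumes A: "finite A" "a \<in> A" "b \<in> A"
    and ker: "(Var a - Var b :: ('v, 'k::field) mpoly) \<in> var_map_kernel A \<psi>"
  shows "\<psi> a = \<psi> b"
proof -
  interpret Vector_Spaces.linear mpoly_scale mpoly_scale
      "var_map A \<psi> :: ('v, 'k) mpoly \<Rightarrow> _"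
    by (rule var_map_linear)
  have "var_map A \<psi> (Var a - Var b :: ('v, 'k) mpoly) = 0"
    using ker by (simp add: var_map_kernel_def)
  then have "Var (\<psi> a) = (Var (\<psi> b) :: (_, 'k) mpoly)"
    using A by (simp add: diff var_map_Var)
  then show ?thesis by simp
qed


section \<open>Regularity of the basis\<close>

theorem theorem5p6:
  fixes P :: "'p::order set" and R :: "'r::order set" and n :: nat
    and \<psi> :: "'p \<times> nat \<Rightarrow> 'r" and J :: "('p \<Rightarrow> nat) set"
    and B :: "('p \<times> nat, 'k::field) mpoly set"
  assumes "n \<ge> 1" and "finite P"
    and "\<psi> \<in> P \<times> {1..n} \<rightarrow> R"
    and "monotone_on (P \<times> {1..n}) (rel_prod (\<le>) (\<le>)) (\<le>) \<psi>"
    and "left_strict_chain_fibers P n R \<psi>"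
    and "poset_ideal (pointwise_le P) (isotone_maps P n) J"
    and "is_basis B (var_map_kernel (P \<times> {1..n}) \<psi>)"
    and "\<forall>b\<in>B. \<exists>a \<in> P \<times> {1..n}. \<exists>a' \<in> P \<times> {1..n}. \<psi> a = \<psi> a' \<and> b = Var a - Var a'"
  shows "finite B \<and>
    (\<forall>bs. distinct bs \<and> set bs = B \<longrightarrow>
      regular_sequence
        (poly_ring (P \<times> {1..n}) Quot coletterplace_ideal P n J)
        (map (\<lambda>b. coletterplace_ideal P n J +>\<^bsub>poly_ring (P \<times> {1..n})\<^esub> b) bs))"
proof (intro conjI allI impI)
  let ?A = "P \<times> {1..n}"
  let ?S = "poly_ring ?A :: ('p \<times> nat, 'k) mpoly ring"
  let ?L = "coletterplace_ideal P n J :: ('p \<times> nat, 'k) mpoly set"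
  interpret S: cring ?S
    by (rule poly_ring_cring)
  have "finite ?A"
    using \<open>finite P\<close> by simp
  have diffs: "\<exists>a\<in>?A. \<exists>a'\<in>?A. \<psi> a = \<psi> a' \<and> b = Var a - Var a'" if "b \<in> B" for b
    using assms(8) that by blast
  have "B \<subseteq> (\<lambda>(a, a'). Var a - Var a') ` (?A \<times> ?A)"
    using diffs by fast
  then show "finite B"
    by (rule finite_subset) (intro finite_imageI finite_cartesian_product \<open>finite ?A\<close>)
  have J: "J \<subseteq> isotone_maps P n"
    using assms(6) by (simp add: poset_ideal_def)
  have indep: "mpoly.independent B" and span: "mpoly.span B = var_map_kernel ?A \<psi>"
    using assms(7) by (simp_all add: is_basis_def)
  have B_carr: "B \<subseteq> carrier ?S"
  proof
    fix b assume "b \<in> B"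
    then obtain a a' where "a \<in> ?A" "a' \<in> ?A" "b = Var a - Var a'"
      using diffs by blast
    then show "b \<in> carrier ?S"
      using keys_diff[of "Var a" "Var a' :: ('p \<times> nat, 'k) mpoly"]
      by (force simp: poly_ring_def Var_def split: if_splits)
  qed
  fix bs assume bs: "distinct bs \<and> set bs = B"
  show "regular_sequence (?S Quot ?L) (map (\<lambda>b. ?L +>\<^bsub>?S\<^esub> b) bs)"
  proof (rule S.regular_sequence_quotientI)
    show "ideal ?L ?S"
      using J by (rule ideal_coletterplace_ideal)
    show "set bs \<subseteq> carrier ?S"
      using bs B_carr by simp
    fix i f
    assume i: "i < length bs" and f: "f \<in> carrier ?S"
    let ?E = "set (take i bs)"
    assume "bs ! i \<otimes>\<^bsub>?S\<^esub> f \<in> Idl\<^bsub>?S\<^esub> (?L \<union> ?E)"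
    then have bf: "bs ! i * f \<in> Idl\<^bsub>?S\<^esub> (?L \<union> ?E)"
      by simp
    have EB: "?E \<subseteq> B - {bs ! i}"
      using bs i by (auto simp: in_set_conv_nth nth_eq_iff_index_eq dest: in_set_takeD)
    then have E_carr: "?E \<subseteq> carrier ?S"
      using B_carr by blast
    obtain \<rho> where \<rho>: "\<rho> \<in> ?A \<rightarrow> ?A"
      "\<And>v. v \<in> ?A \<Longrightarrow> Var v - Var (\<rho> v) \<in> mpoly.span ?E"
      and \<rho>_eq: "\<And>v w. v \<in> ?A \<Longrightarrow> w \<in> ?A \<Longrightarrow> Var v - Var w \<in> mpoly.span ?E \<Longrightarrow> \<rho> v = \<rho> w"
      using exists_representatives[of ?A ?E] by blast
    have \<rho>_span: "Var v - Var w \<in> mpoly.span ?E" if "v \<in> ?A" "w \<in> ?A" "\<rho> v = \<rho> w" for v w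
    proof -
      have "(Var v - Var (\<rho> v)) - (Var w - Var (\<rho> w)) \<in> mpoly.span ?E"
        using that(1,2)[THEN \<rho>(2)] by (rule mpoly.span_diff)
      then show ?thesis using that(3) by simp
    qed
    have "mpoly.span ?E \<subseteq> var_map_kernel ?A \<psi>"
      using mpoly.span_mono[of ?E B] EB span by blast
    then have \<psi>_eq: "\<psi> v = \<psi> w" if "v \<in> ?A" "w \<in> ?A" "\<rho> v = \<rho> w" for v w
      using eq_if_Var_diff_in_kernel[OF \<open>finite ?A\<close>] \<rho>_span that by blast
    interpret split_fibers P n R \<psi> J \<rho>
      using assms(2,3,5,6) \<psi>_eq by unfold_locales
    have E_zero: "subst_vars \<rho> b = 0" if b: "b \<in> ?E" for b
    proof -
      obtain a a' where a: "a \<in> ?A" "a' \<in> ?A" "b = Var a - Var a'"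
        using diffs EB b by blast
      then have "\<rho> a = \<rho> a'"
        using b by (intro \<rho>_eq mpoly.span_base) auto
      then show ?thesis
        using a by (simp add: push_diff)
    qed
    have mem_iff: "g \<in> Idl\<^bsub>?S\<^esub> (?L \<union> ?E) \<longleftrightarrow> Poly_Mapping.keys (subst_vars \<rho> g) \<subseteq> image_monomials P \<rho> J"
      if "g \<in> carrier ?S" for g
      using \<open>finite P\<close> J E_carr E_zero \<rho> that by (rule genideal_coletterplace_iff)
    obtain a a' where a: "a \<in> ?A" "a' \<in> ?A" "\<psi> a = \<psi> a'" "bs ! i = Var a - Var a'"
      using diffs bs i nth_mem by blast
    have b: "bs ! i \<in> carrier ?S"
      using bs i B_carr nth_mem by blast
    \<comment> \<open>The next difference joins two classes not yet identified, by linear independence.\<close>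
    have ne: "\<rho> a \<noteq> \<rho> a'"
    proof
      assume "\<rho> a = \<rho> a'"
      then have "bs ! i \<in> mpoly.span (B - {bs ! i})"
        using \<rho>_span a mpoly.span_mono[OF EB] by auto
      moreover have "bs ! i \<in> B"
        using bs i by auto
      ultimately show False
        using indep by (auto simp: mpoly.dependent_def)
    qed
    have keys: "Poly_Mapping.keys ((Var (\<rho> a) - Var (\<rho> a')) * subst_vars \<rho> f) \<subseteq> image_monomials P \<rho> J"
    proof -
      have "bs ! i * f \<in> carrier ?S"
        using S.m_closed[OF b f] by simp
      then have "Poly_Mapping.keys (subst_vars \<rho> (bs ! i * f)) \<subseteq> image_monomials P \<rho> J"
        using bf mem_iff by blast
      then show ?thesis
        by (simp only: a(4) subst_vars_mult push_diff subst_vars_Var)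
    qed
    have "Poly_Mapping.keys (subst_vars \<rho> f) \<subseteq> image_monomials P \<rho> J"
    proof (rule var_diff_nonzerodivisor_mod_monomials[OF up_closed_image_monomials _ ne keys])
      fix u
      assume "u + Poly_Mapping.single (\<rho> a) 1 \<in> image_monomials P \<rho> J"
      then obtain \<phi> where \<phi>: "\<phi> \<in> J"
        "\<And>v. card (hits P \<rho> \<phi> v) \<le> Poly_Mapping.lookup u v + (if v = \<rho> a then 1 else 0)"
        unfolding add_single_mem_image_monomials_iff by blast
      assume "u + Poly_Mapping.single (\<rho> a') 1 \<in> image_monomials P \<rho> J"
      then obtain \<chi> where \<chi>: "\<chi> \<in> J"
        "\<And>v. card (hits P \<rho> \<chi> v) \<le> Poly_Mapping.lookup u v + (if v = \<rho> a' then 1 else 0)"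
        unfolding add_single_mem_image_monomials_iff by blast
      show "u \<in> image_monomials P \<rho> J"
        using exists_below_if_exists_below_both[OF \<phi> \<chi> a(1) refl a(2) refl a(3) ne]
        by (simp add: image_monomials_def)
    qed
    then show "f \<in> Idl\<^bsub>?S\<^esub> (?L \<union> ?E)"
      using mem_iff[OF f] by blast
  qed
qed

end
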